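(* Fix an integer $k\ge 2$. For every integer $q\ge 1$ let $M_{k,q}:=\max\{N_{k,q}(S): S\subseteq[q]^{k-1}\}$. Then \[ \lim_{q\to\infty}\frac{M_{k,q}}{q^k}=\lambda_{k-1}. \] Consequently, as $q\to\infty$, \[ \alpha(k,q)=\lambda_{k-1}q^k+o(q^k), \] and the same asymptotic formula holds for $\alpha_{\operatorname{loop}}(k,q)$.
   Context: Let $[q]:=\{0,1,\dots,q-1\}$. The de Bruijn digraph $B(k,q)$ has vertex set $[q]^k$ and directed edges $x_1x_2\dots x_k\to x_2\dots x_k y$ for $y\in[q]$. In its underlying simple graph (self-loops deleted), two distinct words $u=x_1\dots x_k$ and $v=y_1\dots y_k$ are adjacent iff $x_2\dots x_k=y_1\dots y_{k-1}$ or $y_2\dots y_k=x_1\dots x_{k-1}$. $\alpha(k,q)$ denotes the independence number of this simple graph. $\alpha_{\operatorname{loop}}(k,q)$ denotes the independence number when the self-loops are retained, i.e. the maximum size of an independent set of the simple graph containing none of the $q$ constant words $a^k$. For $S\subseteq[q]^{k-1}$, $N_{k,q}(S)$ is the number of words $(x_1,\dots,x_k)\in[q]^k$ with $(x_1,\dots,x_{k-1})\in S$ and $(x_2,\dots,x_k)\notin S$. For $m\ge1$ and measurable $A\subseteq[0,1]^m$, \[ \Phi_m(A):=\int_{[0,1]^{m+1}}\mathbf 1_A(x_1,\dots,x_m)\bigl(1-\mathbf 1_A(x_2,\dots,x_{m+1})\bigr)\,dx_1\cdots dx_{m+1}, \] and $\lambda_m:=\sup\{\Phi_m(A): A\subseteq[0,1]^m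 \text{ measurable}\}$. *)

theory Defs
  imports
    "HOL-Analysis.Analysis"
    "HOL-Library.Landau_Symbols"
    "Graph_Theory.Pair_Digraph"
begin

definition words :: "nat \<Rightarrow> nat \<Rightarrow> nat list set" where
  "words q k = {w. set w \<subseteq> {..<q} \<and> length w = k}"

definition de_bruijn :: "nat \<Rightarrow> nat \<Rightarrow> nat list pair_pre_digraph" where
  "de_bruijn k q =
     \<lparr>pverts = words q k, parcs = {(w, tl w @ [y]) | w y. w \<in> words q k \<and> y < q}\<rparr>"

text \<open>Adjacency in the underlying simple graph: orientation is forgotten and self-loops are
  deleted.\<close>

definition simple_adj :: "'a pair_pre_digraph \<Rightarrow> 'a \<Rightarrow> 'a \<Rightarrow> bool" where
  "simple_adj D u v \<longleftrightarrow> u \<noteq> v \<and> ((u, v) \<in> parcs D \<or> (v, u) \<in> parcs D)"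

definition simple_independent :: "'a pair_pre_digraph \<Rightarrow> 'a set \<Rightarrow> bool" where
  "simple_independent D I \<longleftrightarrow> I \<subseteq> pverts D \<and> (\<forall>u\<in>I. \<forall>v\<in>I. \<not> simple_adj D u v)"

definition alpha :: "nat \<Rightarrow> nat \<Rightarrow> nat" where
  "alpha k q = Max {card I | I. simple_independent (de_bruijn k q) I}"

definition alpha_loop :: "nat \<Rightarrow> nat \<Rightarrow> nat" where
  "alpha_loop k q =
     Max {card I | I. simple_independent (de_bruijn k q) I \<and> (\<forall>a<q. replicate k a \<notin> I)}"

text \<open>For a word \<open>w = x\<^sub>1 \<dots> x\<^sub>k\<close>, \<open>butlast w\<close> is \<open>x\<^sub>1 \<dots> x\<^sub>k\<^sub>-\<^sub>1\<close> and \<open>tl w\<close> is \<open>x\<^sub>2 \<dots> x\<^sub>k\<close>.\<close>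

definition cut_count :: "nat \<Rightarrow> nat \<Rightarrow> nat list set \<Rightarrow> nat" where
  "cut_count k q S = card {w \<in> words q k. butlast w \<in> S \<and> tl w \<notin> S}"

definition max_cut_count :: "nat \<Rightarrow> nat \<Rightarrow> nat" where
  "max_cut_count k q = Max {cut_count k q S | S. S \<subseteq> words q (k - 1)}"

text \<open>The maxima above range over finite nonempty sets, and the arcs agree with the
  overlap description of adjacency.\<close>

lemma finite_words [simp]: "finite (words q k)"
  unfolding words_def by (rule finite_lists_length_eq) simp

lemma simple_independent_empty: "simple_independent D {}"
  by (simp add: simple_independent_def)

lemma finite_simple_independent: "finite {I. simple_independent (de_bruijn k q) I}"
  by (rule finite_subset[of _ "Pow (words q k)"])
     (auto simp: simple_independent_def de_bruijn_def)

lemma de_bruijn_arc_iff: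
  assumes "k \<ge> 1"
  shows "(u, v) \<in> parcs (de_bruijn k q) \<longleftrightarrow>
    u \<in> words q k \<and> v \<in> words q k \<and> tl u = butlast v"
proof
  assume "(u, v) \<in> parcs (de_bruijn k q)"
  then obtain y where "u \<in> words q k" "y < q" "v = tl u @ [y]"
    by (auto simp: de_bruijn_def)
  then show "u \<in> words q k \<and> v \<in> words q k \<and> tl u = butlast v"
    using assms by (cases u) (auto simp: words_def)
next
  assume *: "u \<in> words q k \<and> v \<in> words q k \<and> tl u = butlast v"
  then have "v \<noteq> []" using assms by (auto simp: words_def)
  then have "v = tl u @ [last v]" using * by simp
  moreover have "last v < q"
    using * last_in_set[OF \<open>v \<noteq> []\<close>] by (auto simp: words_def)
  ultimately show "(u, v) \<in> parcs (de_bruijn k q)"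
    using * by (auto simp: de_bruijn_def)
qed

text \<open>Points of $\mathbb{R}^m$ are functions that are \<open>undefined\<close> outside \<open>{..<m}\<close>, with the
  coordinates $x_1,\dots,x_m$ at the indices \<open>0, \<dots>, m - 1\<close>. The product measure lives on Borel
  sets; its completion is Lebesgue measure.\<close>

definition lebesgue_pow :: "nat \<Rightarrow> (nat \<Rightarrow> real) measure" where
  "lebesgue_pow m = completion (\<Pi>\<^sub>M i\<in>{..<m}. lborel)"

definition unit_cube :: "nat \<Rightarrow> (nat \<Rightarrow> real) set" where
  "unit_cube m = (\<Pi>\<^sub>E i\<in>{..<m}. {0..1})"

definition Phi :: "nat \<Rightarrow> (nat \<Rightarrow> real) set \<Rightarrow> real" where
  "Phi m A = (LINT x:unit_cube (m + 1)|lebesgue_pow (m + 1).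
     indicator A (\<lambda>i\<in>{..<m}. x i) * (1 - indicator A (\<lambda>i\<in>{..<m}. x (i + 1))))"

definition lambda_sup :: "nat \<Rightarrow> real" where
  "lambda_sup m = Sup {Phi m A | A. A \<subseteq> unit_cube m \<and> A \<in> sets (lebesgue_pow m)}"

end

theory Submission
  imports Defs "HOL-Probability.Probability"
begin

text \<open>Write \<open>m = k - 1\<close>. A set \<open>S\<close> of words of length \<open>m\<close> is blown up to a union of cubes of side
  \<open>1/q\<close>, whose \<open>Phi\<close>-value is \<open>N(S)/q^k\<close>; hence the maximal cut count is at most \<open>lambda q^k\<close>.
  Conversely, given a measurable \<open>A\<close>, choose \<open>t_0, ..., t_(q-1)\<close> independently and uniformly in
  the unit interval and let \<open>S\<close> consist of the words \<open>w\<close> with \<open>(t_(w_1), ..., t_(w_m)) \<in> A\<close>. Every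
  word of length \<open>k\<close> with distinct letters is counted by \<open>N(S)\<close> with probability \<open>Phi A\<close>, and
  almost all words have distinct letters, so some \<open>S\<close> attains \<open>(Phi A - o(1)) q^k\<close>; no approximation
  of \<open>A\<close> is needed.

  A cut yields an independent set without constant words, and an independent set \<open>I\<close> is the cut of
  \<open>S = butlast ` I\<close> up to constant words, so both independence numbers lie between the maximal
  cut count and the maximal cut count plus \<open>q\<close>.\<close>

section \<open>Words, cuts and independent sets\<close>

lemma words_nth_less: "w \<in> words q k \<Longrightarrow> i < k \<Longrightarrow> w ! i < q"
  by (auto simp: words_def dest!: nth_mem)

lemma length_words: "w \<in> words q k \<Longrightarrow> length w = k"
  by (simp add: words_def)

lemma card_words: "card (words q k) = q ^ k"
  unfolding words_def by (subst card_lists_length_eq) auto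

lemma butlast_words: "w \<in> words q k \<Longrightarrow> butlast w \<in> words q (k - 1)"
  by (auto simp: words_def dest: in_set_butlastD)

lemma tl_words: "w \<in> words q k \<Longrightarrow> tl w \<in> words q (k - 1)"
  by (cases w) (auto simp: words_def)

text \<open>Comparing \<open>butlast w\<close> with \<open>tl w\<close> entry by entry equates each
  letter with its successor. Constant words are thus exactly the ones carrying self-loops.\<close>

lemma constant_word:
  assumes "butlast w = tl w" "w \<noteq> []"
  shows "w = replicate (length w) (hd w)"
  using assms
proof (induction w)
  case (Cons a w)
  show ?case
  proof (cases w)
    case (Cons b v)
    then have "a = b" "butlast w = tl w" using Cons.prems by auto
    with Cons Cons.IH show ?thesis by simp
  qed simp
qed simp

lemma max_cut_count_ge: "S \<subseteq> words q (k - 1) \<Longrightarrow> cut_count k q S \<le> max_cut_count k q"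
  unfolding max_cut_count_def by (rule Max_ge) auto

lemma max_cut_count_attained:
  obtains S where "S \<subseteq> words q (k - 1)" "max_cut_count k q = cut_count k q S"
proof -
  have "max_cut_count k q \<in> {cut_count k q S | S. S \<subseteq> words q (k - 1)}"
    unfolding max_cut_count_def by (rule Max_in) auto
  with that show ?thesis by blast
qed

text \<open>The side condition \<open>P\<close> serves both maxima: it is trivially true for
  \<open>alpha\<close> and forbids constant words for \<open>alpha_loop\<close>.\<close>

lemma finite_card_simple_independent:
  "finite {card I | I. simple_independent (de_bruijn k q) I \<and> P I}"
  by (rule finite_subset[of _ "card ` {I. simple_independent (de_bruijn k q) I}"])
    (auto simp: finite_simple_independent)

text \<open>If two words of a cut were joined by an arc from \<open>u\<close> to \<open>v\<close>,
  the common word \<open>tl u = butlast v\<close> would lie both outside and inside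
  \<open>S\<close>. A constant word has \<open>butlast\<close> equal to \<open>tl\<close>, so no cut
  contains one.\<close>

lemma max_cut_count_le_alpha_loop:
  assumes "k \<ge> 1"
  shows "max_cut_count k q \<le> alpha_loop k q"
proof -
  obtain S where S: "S \<subseteq> words q (k - 1)" "max_cut_count k q = cut_count k q S"
    by (rule max_cut_count_attained)
  define I where "I = {w \<in> words q k. butlast w \<in> S \<and> tl w \<notin> S}"
  have "simple_independent (de_bruijn k q) I"
    unfolding simple_independent_def simple_adj_def de_bruijn_arc_iff[OF assms]
    by (auto simp: I_def de_bruijn_def)
  moreover have "\<forall>a<q. replicate k a \<notin> I"
  proof -
    have "butlast (replicate k a) = tl (replicate k a)" for a :: nat
      by (simp add: butlast_conv_take)
    then show ?thesis by (auto simp: I_def)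
  qed
  ultimately show ?thesis
    unfolding alpha_loop_def S(2) cut_count_def I_def[symmetric]
    by (intro Max_ge finite_card_simple_independent) auto
qed

lemma alpha_loop_le_alpha: "alpha_loop k q \<le> alpha k q"
  unfolding alpha_loop_def alpha_def
proof (rule Max_mono)
  show "{card I | I. simple_independent (de_bruijn k q) I \<and> (\<forall>a<q. replicate k a \<notin> I)} \<noteq> {}"
    using simple_independent_empty by blast
  show "finite {card I | I. simple_independent (de_bruijn k q) I}"
    using finite_card_simple_independent[where P = "\<lambda>_. True"] by simp
qed blast

lemma alpha_le:
  assumes "k \<ge> 1"
  shows "alpha k q \<le> max_cut_count k q + q"
proof -
  have "alpha k q \<in> {card I | I. simple_independent (de_bruijn k q) I}"
    unfolding alpha_def
  proof (rule Max_in)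
    show "finite {card I | I. simple_independent (de_bruijn k q) I}"
      using finite_card_simple_independent[where P = "\<lambda>_. True"] by simp
    show "{card I | I. simple_independent (de_bruijn k q) I} \<noteq> {}"
      using simple_independent_empty by blast
  qed
  then obtain I where I: "simple_independent (de_bruijn k q) I" "alpha k q = card I"
    by blast
  have sub: "I \<subseteq> words q k" using I(1) by (simp add: simple_independent_def de_bruijn_def)
  define S where "S = butlast ` I"
  let ?C = "{w \<in> words q k. butlast w \<in> S \<and> tl w \<notin> S}" and ?R = "(\<lambda>a. replicate k a) ` {..<q}"
  have "I \<subseteq> ?C \<union> ?R"
  proof
    fix w assume w: "w \<in> I"
    then have wk: "w \<in> words q k" using sub by blast
    show "w \<in> ?C \<union> ?R"
    proof (cases "tl w \<in> S")
      case False
      then show ?thesis using w wk by (auto simp: S_def)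
    next
      case True
      then obtain v where v: "v \<in> I" "tl w = butlast v" by (auto simp: S_def)
      then have "(w, v) \<in> parcs (de_bruijn k q)"
        using wk sub by (auto simp: de_bruijn_arc_iff[OF assms])
      then have "w = v" using I(1) w v by (auto simp: simple_independent_def simple_adj_def)
      moreover have "w \<noteq> []" using wk assms by (auto simp: words_def)
      moreover from this have "hd w < q" using wk hd_in_set by (fastforce simp: words_def)
      ultimately have "w = replicate k (hd w)" "hd w < q"
        using constant_word[of w] v(2) wk by (auto simp: words_def)
      then show ?thesis by blast
    qed
  qed
  then have "card I \<le> card (?C \<union> ?R)" by (intro card_mono) auto
  also have "\<dots> \<le> card ?C + card ?R" by (rule card_Un_le)
  also have "card ?C \<le> max_cut_count k q"
    using max_cut_count_ge[of S q k] sub butlast_words by (auto simp: S_def cut_count_def)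
  also have "card ?R \<le> q" using card_image_le[of "{..<q}"] by auto
  finally show ?thesis using I(2) by simp
qed

section \<open>The uniform measure on the cube\<close>

definition unit_uniform :: "real measure" where
  "unit_uniform = uniform_measure lborel {0..1}"

text \<open>The underlying space is the whole Euclidean space, so that the sigma-algebra is that of
  the product of \<open>lborel\<close>; the mass sits on the unit cube.\<close>

definition cube_measure :: "nat \<Rightarrow> (nat \<Rightarrow> real) measure" where
  "cube_measure n = (\<Pi>\<^sub>M i\<in>{..<n}. unit_uniform)"

lemma sets_unit_uniform [simp, measurable_cong]: "sets unit_uniform = sets borel"
  by (simp add: unit_uniform_def)

lemma space_unit_uniform [simp]: "space unit_uniform = UNIV"
  by (simp add: unit_uniform_def)

lemma emeasure_unit_uniform:
  "B \<in> sets borel \<Longrightarrow> emeasure unit_uniform B = emeasure lborel ({0..1} \<inter> B)"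
  by (simp add: unit_uniform_def divide_ennreal_def)

lemma prob_space_unit_uniform: "prob_space unit_uniform"
  unfolding unit_uniform_def by (rule prob_space_uniform_measure) auto

lemma prob_space_cube_measure: "prob_space (cube_measure n)"
  unfolding cube_measure_def by (intro prob_space_PiM prob_space_unit_uniform)

lemma sets_cube_measure [measurable_cong]:
  "sets (cube_measure n) = sets (\<Pi>\<^sub>M i\<in>{..<n}. lborel)"
  unfolding cube_measure_def by (intro sets_PiM_cong) auto

lemma space_cube_measure: "space (cube_measure n) = (\<Pi>\<^sub>E i\<in>{..<n}. UNIV)"
  unfolding cube_measure_def by (simp add: space_PiM)

lemma unit_cube_sets [measurable]: "unit_cube n \<in> sets (\<Pi>\<^sub>M i\<in>{..<n}. lborel)"
  unfolding unit_cube_def by (intro sets_PiM_I_finite) auto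

lemma emeasure_cube_measure_box:
  assumes "\<And>i. i < n \<Longrightarrow> B i \<in> sets borel"
  shows "emeasure (cube_measure n) (Pi\<^sub>E {..<n} B) = (\<Prod>i<n. emeasure lborel ({0..1} \<inter> B i))"
proof -
  interpret prob_space unit_uniform by (rule prob_space_unit_uniform)
  interpret product_sigma_finite "\<lambda>_::nat. unit_uniform" by unfold_locales
  show ?thesis
    unfolding cube_measure_def
    using assms by (subst emeasure_PiM) (auto simp: emeasure_unit_uniform intro!: prod.cong)
qed

text \<open>Both measures agree on boxes, which determines a product measure. This links the
  probabilistic view (independent uniform coordinates) to the Lebesgue integral in
  \<open>Phi\<close>.\<close>

lemma cube_measure_eq_density:
  "cube_measure n = density (\<Pi>\<^sub>M i\<in>{..<n}. lborel) (indicator (unit_cube n))"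
proof -
  interpret prob_space unit_uniform by (rule prob_space_unit_uniform)
  interpret U: product_sigma_finite "\<lambda>_::nat. unit_uniform" by unfold_locales
  interpret L: product_sigma_finite "\<lambda>_::nat. lborel :: real measure" by unfold_locales
  show ?thesis
    unfolding cube_measure_def
  proof (rule U.PiM_eqI[symmetric])
    show "sets (density (\<Pi>\<^sub>M i\<in>{..<n}. lborel) (indicator (unit_cube n))) =
        sets (\<Pi>\<^sub>M i\<in>{..<n}. unit_uniform)"
      using sets_cube_measure[of n] by (simp add: cube_measure_def)
    fix B :: "nat \<Rightarrow> real set"
    assume "\<And>i. i \<in> {..<n} \<Longrightarrow> B i \<in> sets unit_uniform"
    then have B: "\<And>i. i \<in> {..<n} \<Longrightarrow> B i \<in> sets borel" by simp
    have "Pi\<^sub>E {..<n} B \<in> sets (\<Pi>\<^sub>M i\<in>{..<n}. lborel)"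
      using B by (intro sets_PiM_I_finite) auto
    then have "emeasure (density (\<Pi>\<^sub>M i\<in>{..<n}. lborel) (indicator (unit_cube n))) (Pi\<^sub>E {..<n} B)
        = emeasure (\<Pi>\<^sub>M i\<in>{..<n}. lborel) (unit_cube n \<inter> Pi\<^sub>E {..<n} B)"
      by (subst emeasure_density)
        (auto simp: indicator_inter_arith[symmetric] simp del: nn_integral_indicator
          intro!: nn_integral_indicator)
    also have "unit_cube n \<inter> Pi\<^sub>E {..<n} B = (\<Pi>\<^sub>E i\<in>{..<n}. {0..1} \<inter> B i)"
      by (auto simp: unit_cube_def PiE_iff)
    also have "emeasure (\<Pi>\<^sub>M i\<in>{..<n}. lborel) \<dots> = (\<Prod>i<n. emeasure unit_uniform (B i))"
      using B by (subst L.emeasure_PiM) (auto simp: emeasure_unit_uniform intro!: prod.cong)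
    finally show "emeasure (density (\<Pi>\<^sub>M i\<in>{..<n}. lborel) (indicator (unit_cube n)))
        (Pi\<^sub>E {..<n} B) = (\<Prod>i\<in>{..<n}. emeasure unit_uniform (B i))" .
  qed simp
qed

lemma AE_cube_measure_iff:
  "(AE x in cube_measure n. P x) \<longleftrightarrow> (AE x in (\<Pi>\<^sub>M i\<in>{..<n}. lborel). x \<in> unit_cube n \<longrightarrow> P x)"
proof -
  have "indicator (unit_cube n) \<in> borel_measurable (\<Pi>\<^sub>M i\<in>{..<n}. (lborel :: real measure))"
    by measurable
  then show ?thesis
    by (subst cube_measure_eq_density, subst AE_density) (auto simp: indicator_def)
qed

lemma measure_cube_measure:
  assumes "D \<in> sets (\<Pi>\<^sub>M i\<in>{..<n}. lborel)"
  shows "measure (cube_measure n) D = measure (\<Pi>\<^sub>M i\<in>{..<n}. lborel) (unit_cube n \<inter> D)"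
  unfolding cube_measure_eq_density measure_def
  using assms by (subst emeasure_density)
    (auto simp: indicator_inter_arith[symmetric] simp del: nn_integral_indicator
          intro!: arg_cong[where f = enn2real] nn_integral_indicator)

text \<open>An injective \<open>f\<close> selects different coordinates, which are again independent
  and uniform. It is applied to the two projections in \<open>Phi\<close> and to the letters of a
  word with distinct letters.\<close>

lemma distr_cube_measure_reindex:
  assumes "inj_on f {..<n}" "\<And>i. i < n \<Longrightarrow> f i < p"
  shows "distr (cube_measure p) (cube_measure n) (\<lambda>x. \<lambda>i\<in>{..<n}. x (f i)) = cube_measure n"
  unfolding cube_measure_def
  using assms by (intro distr_PiM_reindex prob_space_unit_uniform) auto

lemma measurable_cube_measure_reindex [measurable]:
  assumes "\<And>i. i < n \<Longrightarrow> f i < p"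
  shows "(\<lambda>x. \<lambda>i\<in>{..<n}. x (f i)) \<in> cube_measure p \<rightarrow>\<^sub>M cube_measure n"
  unfolding cube_measure_def using assms by (intro measurable_restrict measurable_component_singleton) auto

section \<open>\<open>Phi\<close> as the probability of a cut event\<close>

definition cut_event :: "nat \<Rightarrow> (nat \<Rightarrow> real) set \<Rightarrow> (nat \<Rightarrow> real) set" where
  "cut_event m A = {x \<in> space (cube_measure (m + 1)).
     (\<lambda>i\<in>{..<m}. x i) \<in> A \<and> (\<lambda>i\<in>{..<m}. x (i + 1)) \<notin> A}"

lemma cut_event_sets:
  assumes "A \<in> sets (cube_measure m)"
  shows "cut_event m A \<in> sets (cube_measure (m + 1))"
proof -
  note [measurable] = assms
  have [measurable]: "(\<lambda>x. \<lambda>i\<in>{..<m}. x i) \<in> cube_measure (m + 1) \<rightarrow>\<^sub>M cube_measure m"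
    by (rule measurable_cube_measure_reindex) simp
  have [measurable]: "(\<lambda>x. \<lambda>i\<in>{..<m}. x (i + 1)) \<in> cube_measure (m + 1) \<rightarrow>\<^sub>M cube_measure m"
    by (rule measurable_cube_measure_reindex) simp
  show ?thesis unfolding cut_event_def by measurable
qed

text \<open>The reindexing map preserves the measure, so it pulls null sets back to null
  sets.\<close>

lemma AE_reindex:
  assumes "AE x in cube_measure n. P x" "inj_on f {..<n}" "\<And>i. i < n \<Longrightarrow> f i < p"
  shows "AE x in cube_measure p. P (\<lambda>i\<in>{..<n}. x (f i))"
proof -
  have "AE x in distr (cube_measure p) (cube_measure n) (\<lambda>x. \<lambda>i\<in>{..<n}. x (f i)). P x"
    using assms(1) by (subst distr_cube_measure_reindex[OF assms(2,3)])
  then show ?thesis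
    by (rule AE_distrD[rotated]) (rule measurable_cube_measure_reindex[OF assms(3)])
qed

text \<open>The Borel set \<open>B\<close> differs from \<open>A\<close> by a null set, so the two integrands of \<open>Phi\<close> agree almost
  everywhere because both coordinate projections preserve the uniform measure.\<close>

lemma Phi_eq_measure:
  assumes "A \<in> sets (lebesgue_pow m)"
  obtains B where "B \<in> sets (cube_measure m)" "Phi m A = measure (cube_measure (m + 1)) (cut_event m B)"
    "A \<in> sets (cube_measure m) \<Longrightarrow> B = A"
proof
  let ?L = "\<lambda>n. (\<Pi>\<^sub>M i\<in>{..<n}. lborel) :: (nat \<Rightarrow> real) measure"
  define B where "B = main_part (?L m) A"
  have A: "A \<in> sets (completion (?L m))" using assms by (simp add: lebesgue_pow_def)
  show B: "B \<in> sets (cube_measure m)"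
    using A by (auto simp: sets_cube_measure B_def)
  show "A \<in> sets (cube_measure m) \<Longrightarrow> B = A"
    by (simp add: sets_cube_measure B_def)
  have "AE x in ?L m. x \<in> A \<longleftrightarrow> x \<in> B"
    using AE_notin_null_part[OF A] main_part_null_part_Un[OF A]
    by (auto simp: B_def elim!: eventually_mono)
  then have AE: "AE x in cube_measure m. x \<in> A \<longleftrightarrow> x \<in> B"
    unfolding AE_cube_measure_iff by auto
  let ?D = "\<lambda>A. unit_cube (m + 1) \<inter> cut_event m A"
  have "AE x in cube_measure (m + 1). (\<lambda>i\<in>{..<m}. x i) \<in> A \<longleftrightarrow> (\<lambda>i\<in>{..<m}. x i) \<in> B"
    by (rule AE_reindex[OF AE]) auto
  moreover have "AE x in cube_measure (m + 1).
      (\<lambda>i\<in>{..<m}. x (i + 1)) \<in> A \<longleftrightarrow> (\<lambda>i\<in>{..<m}. x (i + 1)) \<in> B"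
    by (rule AE_reindex[OF AE]) auto
  ultimately have "AE x in ?L (m + 1). x \<in> ?D B \<longleftrightarrow> x \<in> ?D A"
    unfolding AE_cube_measure_iff by eventually_elim (auto simp: cut_event_def)
  then have AED: "AE x in completion (?L (m + 1)). x \<in> ?D B \<longleftrightarrow> x \<in> ?D A"
    by (rule AE_completion)
  have DB: "?D B \<in> sets (?L (m + 1))"
    using cut_event_sets[OF B] unit_cube_sets[of "m + 1"] by (auto simp: sets_cube_measure)
  have sub: "?D A \<subseteq> space (completion (?L (m + 1)))"
    by (auto simp: unit_cube_def space_PiM)
  \<comment> \<open>For a Lebesgue set \<open>A\<close> the measurability of \<open>?D A\<close> is
    not immediate; it follows from completeness, since \<open>?D A\<close> agrees almost everywhere
    with the Borel set \<open>?D B\<close>.\<close>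
  have DA: "?D A \<in> sets (completion (?L (m + 1)))"
    using AED DB sub by (intro completion.in_sets_AE[OF AED]) auto
  have "Phi m A = (\<integral>x. indicator (?D A) x \<partial>completion (?L (m + 1)))"
    unfolding Phi_def lebesgue_pow_def set_lebesgue_integral_def
    by (rule Bochner_Integration.integral_cong)
      (auto simp: indicator_def cut_event_def space_cube_measure unit_cube_def)
  also have "\<dots> = measure (completion (?L (m + 1))) (?D A)"
    using sub by (simp add: Int_absorb2)
  also have "\<dots> = measure (completion (?L (m + 1))) (?D B)"
    using AED DA DB by (intro measure_eq_AE) auto
  also have "\<dots> = measure (?L (m + 1)) (?D B)"
    using DB by simp
  also have "\<dots> = measure (cube_measure (m + 1)) (cut_event m B)"
    using cut_event_sets[OF B] by (subst measure_cube_measure) (auto simp: sets_cube_measure)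
  finally show "Phi m A = measure (cube_measure (m + 1)) (cut_event m B)" .
qed

text \<open>The representative of a Borel set is the set itself, so the cut event of
  \<open>A\<close> can be used directly.\<close>

lemma Phi_borel:
  assumes "A \<in> sets (cube_measure m)"
  shows "Phi m A = measure (cube_measure (m + 1)) (cut_event m A)"
proof -
  have "A \<in> sets (lebesgue_pow m)"
    using assms by (auto simp: lebesgue_pow_def sets_cube_measure)
  with Phi_eq_measure assms show ?thesis by metis
qed

lemma Phi_le_1:
  assumes "A \<in> sets (lebesgue_pow m)"
  shows "Phi m A \<le> 1"
  using Phi_eq_measure[OF assms] prob_space.prob_le_1[OF prob_space_cube_measure] by metis

text \<open>Boundedness makes the real \<open>Sup\<close> in \<open>lambda_sup\<close> a genuine
  upper bound of the values of \<open>Phi\<close>.\<close>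

lemma bdd_above_Phi: "bdd_above {Phi m A | A. A \<subseteq> unit_cube m \<and> A \<in> sets (lebesgue_pow m)}"
  using Phi_le_1 by (intro bdd_aboveI[of _ 1]) auto

lemma Phi_le_lambda_sup:
  "A \<subseteq> unit_cube m \<Longrightarrow> A \<in> sets (lebesgue_pow m) \<Longrightarrow> Phi m A \<le> lambda_sup m"
  unfolding lambda_sup_def by (rule cSup_upper[OF _ bdd_above_Phi]) auto

section \<open>Upper bound: blowing words up to boxes\<close>

definition word_box :: "nat \<Rightarrow> nat list \<Rightarrow> (nat \<Rightarrow> real) set" where
  "word_box q w = (\<Pi>\<^sub>E i\<in>{..<length w}. {real (w ! i) / real q ..< (real (w ! i) + 1) / real q})"

lemma word_box_sets: "length w = n \<Longrightarrow> word_box q w \<in> sets (cube_measure n)"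
  by (auto simp: word_box_def sets_cube_measure intro!: sets_PiM_I_finite)

lemma word_box_subset:
  assumes "w \<in> words q n"
  shows "word_box q w \<subseteq> unit_cube n"
proof
  fix x assume x: "x \<in> word_box q w"
  have "x i \<in> {0..1}" if "i < n" for i
  proof -
    have "real (w ! i) / real q \<le> x i" "x i < (real (w ! i) + 1) / real q"
      using x that length_words[OF assms] by (auto simp: word_box_def PiE_iff)
    moreover have "(real (w ! i) + 1) / real q \<le> 1"
      using words_nth_less[OF assms that] by (simp add: divide_simps)
    moreover have "0 \<le> real (w ! i) / real q" by simp
    ultimately show ?thesis by (simp only: atLeastAtMost_iff) linarith
  qed
  then show "x \<in> unit_cube n"
    using x length_words[OF assms] by (auto simp: word_box_def unit_cube_def PiE_iff)
qed

lemma measure_word_box: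
  assumes "w \<in> words q n"
  shows "measure (cube_measure n) (word_box q w) = 1 / real q ^ n"
proof -
  have "emeasure lborel ({0..1} \<inter> {real (w ! i) / real q ..< (real (w ! i) + 1) / real q})
      = ennreal (1 / real q)" if "i < n" for i
  proof -
    have "(real (w ! i) + 1) / real q \<le> 1"
      using words_nth_less[OF assms that] by (simp add: divide_simps)
    moreover have "0 \<le> real (w ! i) / real q" by simp
    ultimately have "{0..1} \<inter> {real (w ! i) / real q ..< (real (w ! i) + 1) / real q} =
        {real (w ! i) / real q ..< (real (w ! i) + 1) / real q}"
      by (auto simp only: atLeastAtMost_iff atLeastLessThan_iff Int_iff set_eq_iff)
    then show ?thesis
      by (simp add: add_divide_distrib)
  qed
  then have "emeasure (cube_measure n) (word_box q w) = (\<Prod>i<n. ennreal (1 / real q))"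
    unfolding word_box_def length_words[OF assms]
    by (subst emeasure_cube_measure_box) (auto intro!: prod.cong)
  then show ?thesis
    by (simp add: measure_def prod_ennreal[symmetric] ennreal_power power_one_over)
qed

text \<open>The sides of a box are half-open, so the floor of \<open>q * x i\<close> recovers the
  letter at position \<open>i\<close>.\<close>

lemma word_box_unique:
  assumes "x \<in> word_box q v" "x \<in> word_box q w" "length v = length w" "q > 0"
  shows "v = w"
proof (rule nth_equalityI[OF assms(3)])
  fix i assume i: "i < length v"
  have "\<lfloor>real q * x i\<rfloor> = int (u ! i)" if "x \<in> word_box q u" "i < length u" for u
    using that assms(4) by (intro floor_unique)
      (auto simp: word_box_def PiE_iff field_simps)
  from this[of v] this[of w] show "v ! i = w ! i" using assms i by simp
qed

lemma disjoint_family_word_box: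
  assumes "q > 0"
  shows "disjoint_family_on (word_box q) (words q n)"
  unfolding disjoint_family_on_def
  using word_box_unique[OF _ _ _ assms] length_words by blast

lemma word_box_butlast:
  assumes "x \<in> word_box q w" "w \<in> words q (m + 1)"
  shows "(\<lambda>i\<in>{..<m}. x i) \<in> word_box q (butlast w)"
  using assms length_words[OF assms(2)] by (auto simp: word_box_def PiE_iff nth_butlast)

lemma word_box_tl:
  assumes "x \<in> word_box q w" "w \<in> words q (m + 1)"
  shows "(\<lambda>i\<in>{..<m}. x (i + 1)) \<in> word_box q (tl w)"
  using assms length_words[OF assms(2)] by (auto simp: word_box_def PiE_iff nth_tl)

text \<open>The boxes of the counted words are disjoint, have volume \<open>1 / q ^ (m + 1)\<close>
  each and lie in the cut event of the blow-up \<open>A\<close> of \<open>S\<close>. Adding the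
  volumes bounds the normalised cut count by \<open>Phi m A\<close>.\<close>

lemma cut_count_le_lambda_sup:
  assumes S: "S \<subseteq> words q m" and q: "q > 0"
  shows "real (cut_count (m + 1) q S) \<le> lambda_sup m * real q ^ (m + 1)"
proof -
  define A where "A = (\<Union>w\<in>S. word_box q w)"
  have fin: "finite S" using finite_subset[OF S] by simp
  have A: "A \<in> sets (cube_measure m)"
    unfolding A_def using S fin by (intro sets.finite_UN word_box_sets) (auto simp: length_words)
  have Asub: "A \<subseteq> unit_cube m" unfolding A_def using word_box_subset S by blast
  define C where "C = {w \<in> words q (m + 1). butlast w \<in> S \<and> tl w \<notin> S}"
  have sub: "(\<Union>w\<in>C. word_box q w) \<subseteq> cut_event m A"
  proof
    fix x assume "x \<in> (\<Union>w\<in>C. word_box q w)"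
    then obtain w where w: "w \<in> words q (m + 1)" "butlast w \<in> S" "tl w \<notin> S" "x \<in> word_box q w"
      by (auto simp: C_def)
    have "(\<lambda>i\<in>{..<m}. x i) \<in> A"
      using word_box_butlast[OF w(4,1)] w(2) by (auto simp: A_def)
    \<comment> \<open>The shifted point lies in the box of \<open>tl w\<close>. If it were also in
      the box of some word of \<open>S\<close>, that word would be \<open>tl w\<close>, which is not
      in \<open>S\<close>.\<close>
    moreover have "(\<lambda>i\<in>{..<m}. x (i + 1)) \<notin> A"
    proof
      assume "(\<lambda>i\<in>{..<m}. x (i + 1)) \<in> A"
      then obtain v where v: "v \<in> S" "(\<lambda>i\<in>{..<m}. x (i + 1)) \<in> word_box q v"
        by (auto simp: A_def)
      have "length v = length (tl w)"
        using S v(1) length_words[OF w(1)] length_words[of v q m] by auto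
      then have "v = tl w" using word_box_unique[OF v(2) word_box_tl[OF w(4,1)]] q by blast
      with v w show False by simp
    qed
    moreover have "x \<in> space (cube_measure (m + 1))"
      using sets.sets_into_space[OF word_box_sets] w(4) length_words[OF w(1)] by blast
    ultimately show "x \<in> cut_event m A" by (simp add: cut_event_def)
  qed
  interpret prob_space "cube_measure (m + 1)" by (rule prob_space_cube_measure)
  have finC: "finite C" by (simp add: C_def)
  have "real (card C) / real q ^ (m + 1) = (\<Sum>w\<in>C. measure (cube_measure (m + 1)) (word_box q w))"
    by (simp add: C_def measure_word_box)
  also have "\<dots> = measure (cube_measure (m + 1)) (\<Union>w\<in>C. word_box q w)"
    using finC by (intro finite_measure_finite_Union[symmetric])
      (auto simp: C_def length_words intro!: word_box_sets
        disjoint_family_on_mono[OF _ disjoint_family_word_box[OF q]])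
  also have "\<dots> \<le> measure (cube_measure (m + 1)) (cut_event m A)"
    using sub cut_event_sets[OF A] by (intro finite_measure_mono) auto
  also have "\<dots> = Phi m A" by (simp add: Phi_borel[OF A])
  also have "\<dots> \<le> lambda_sup m"
    using A Asub by (intro Phi_le_lambda_sup) (auto simp: lebesgue_pow_def sets_cube_measure)
  finally show ?thesis
    using q by (simp add: cut_count_def C_def divide_simps)
qed

lemma max_cut_count_upper:
  assumes "q > 0"
  shows "real (max_cut_count (m + 1) q) / real q ^ (m + 1) \<le> lambda_sup m"
proof -
  obtain S where S: "S \<subseteq> words q (m + 1 - 1)" "max_cut_count (m + 1) q = cut_count (m + 1) q S"
    by (rule max_cut_count_attained)
  with cut_count_le_lambda_sup[of S q m] assms show ?thesis by (simp add: divide_simps)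
qed

section \<open>Lower bound: random points as letters\<close>

lemma max_cut_count_lower_Phi:
  assumes "A \<in> sets (lebesgue_pow m)"
  shows "Phi m A * real (card {w \<in> words q (m + 1). distinct w}) \<le> real (max_cut_count (m + 1) q)"
proof -
  obtain B where B: "B \<in> sets (cube_measure m)"
    and Phi: "Phi m A = measure (cube_measure (m + 1)) (cut_event m B)"
    by (rule Phi_eq_measure[OF assms])
  \<comment> \<open>The random point \<open>t\<close> labels each letter \<open>a < q\<close> by the
    real number \<open>t a\<close>; \<open>E w\<close> is the event that \<open>w\<close> is counted
    for the set of words defined by \<open>t\<close>.\<close>
  define E where "E w = {t \<in> space (cube_measure q). (\<lambda>i\<in>{..<m + 1}. t (w ! i)) \<in> cut_event m B}"
    for w
  have E_meas: "E w \<in> sets (cube_measure q)" if "w \<in> words q (m + 1)" for w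
  proof -
    have "(\<lambda>t. \<lambda>i\<in>{..<m + 1}. t (w ! i)) \<in> cube_measure q \<rightarrow>\<^sub>M cube_measure (m + 1)"
      using words_nth_less[OF that] by (intro measurable_cube_measure_reindex) auto
    from measurable_sets[OF this cut_event_sets[OF B]] show ?thesis
      by (simp add: E_def vimage_def Int_def conj_commute)
  qed
  interpret prob_space "cube_measure q" by (rule prob_space_cube_measure)
  let ?W = "words q (m + 1)"
  have prob_E: "measure (cube_measure q) (E w) = Phi m A" if w: "w \<in> ?W" "distinct w" for w
  proof -
    have lt: "\<And>i. i < m + 1 \<Longrightarrow> w ! i < q" using words_nth_less[OF w(1)] .
    \<comment> \<open>Distinct letters make the labels along \<open>w\<close> independent, so the
      labelled word is uniform on the cube of dimension \<open>m + 1\<close>.\<close>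
    have inj: "inj_on ((!) w) {..<m + 1}"
      using w length_words[OF w(1)] by (auto simp: inj_on_def nth_eq_iff_index_eq)
    have "Phi m A = measure (distr (cube_measure q) (cube_measure (m + 1))
        (\<lambda>t. \<lambda>i\<in>{..<m + 1}. t (w ! i))) (cut_event m B)"
      unfolding Phi by (subst distr_cube_measure_reindex[OF inj lt]) auto
    also have "\<dots> = measure (cube_measure q) (E w)"
      using measurable_cube_measure_reindex[OF lt] cut_event_sets[OF B]
      by (subst measure_distr) (auto simp: E_def vimage_def Int_def conj_commute)
    finally show ?thesis by simp
  qed
  have int: "integrable (cube_measure q) (indicator (E w) :: _ \<Rightarrow> real)" if "w \<in> ?W" for w
    using E_meas[OF that] by (intro integrable_real_indicator) (auto simp: emeasure_eq_measure)
  \<comment> \<open>For each fixed \<open>t\<close> the number of events \<open>E w\<close> that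
    occur is the cut count of one set \<open>S\<close>, so it never exceeds the maximum. Integrating
    over \<open>t\<close> bounds the expected count.\<close>
  have count: "(\<Sum>w\<in>?W. indicator (E w) t) \<le> real (max_cut_count (m + 1) q)"
    if t: "t \<in> space (cube_measure q)" for t
  proof -
    define S where "S = {v \<in> words q m. (\<lambda>i\<in>{..<m}. t (v ! i)) \<in> B}"
    have "w \<in> ?W \<and> t \<in> E w \<longleftrightarrow> w \<in> ?W \<and> butlast w \<in> S \<and> tl w \<notin> S" for w
    proof (cases "w \<in> ?W")
      case True
      note len = length_words[OF True]
      have "(\<lambda>i\<in>{..<m}. (\<lambda>i\<in>{..<m + 1}. t (w ! i)) i) = (\<lambda>i\<in>{..<m}. t (butlast w ! i))"
        using len by (auto simp: restrict_def nth_butlast fun_eq_iff)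
      moreover have "(\<lambda>i\<in>{..<m}. (\<lambda>i\<in>{..<m + 1}. t (w ! i)) (i + 1)) = (\<lambda>i\<in>{..<m}. t (tl w ! i))"
        using len by (auto simp: restrict_def nth_tl fun_eq_iff)
      ultimately show ?thesis
        using True t butlast_words[OF True] tl_words[OF True]
        by (auto simp: E_def S_def cut_event_def space_cube_measure simp del: restrict_apply)
    qed simp
    then have "{w \<in> ?W. t \<in> E w} = {w \<in> ?W. butlast w \<in> S \<and> tl w \<notin> S}" by auto
    then have "(\<Sum>w\<in>?W. indicator (E w) t) = real (cut_count (m + 1) q S)"
      by (simp add: indicator_def cut_count_def sum.If_cases Int_def)
    also have "\<dots> \<le> real (max_cut_count (m + 1) q)"
      using max_cut_count_ge[of S q "m + 1"] by (auto simp: S_def)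
    finally show ?thesis .
  qed
  have "Phi m A * real (card {w \<in> ?W. distinct w}) =
      (\<Sum>w\<in>{w \<in> ?W. distinct w}. measure (cube_measure q) (E w))"
    by (simp add: prob_E)
  \<comment> \<open>Words with a repeated letter have unknown but nonnegative probability, so adding
    them only increases the sum.\<close>
  also have "\<dots> \<le> (\<Sum>w\<in>?W. measure (cube_measure q) (E w))"
    by (intro sum_mono2) auto
  also have "\<dots> = (\<Sum>w\<in>?W. \<integral>t. indicator (E w) t \<partial>cube_measure q)"
    using E_meas sets.sets_into_space by (intro sum.cong) (auto simp: Int_absorb2)
  also have "\<dots> = (\<integral>t. (\<Sum>w\<in>?W. indicator (E w) t) \<partial>cube_measure q)"
    using int by (intro Bochner_Integration.integral_sum[symmetric]) auto
  also have "\<dots> \<le> (\<integral>t. real (max_cut_count (m + 1) q) \<partial>cube_measure q)"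
    using int count by (intro integral_mono) auto
  also have "\<dots> = real (max_cut_count (m + 1) q)" by (simp add: prob_space)
  finally show ?thesis .
qed

section \<open>Density of words with distinct letters\<close>

lemma card_distinct_words_ge:
  assumes "k \<le> q"
  shows "(q - k + 1) ^ k \<le> card {w \<in> words q k. distinct w}"
proof -
  have "{w \<in> words q k. distinct w} = {w. length w = k \<and> distinct w \<and> set w \<subseteq> {..<q}}"
    by (auto simp: words_def)
  then have "card {w \<in> words q k. distinct w} = \<Prod>{q - k + 1..q}"
    using card_lists_distinct_length_eq[of "{..<q}" k] assms by simp
  \<comment> \<open>The count is a falling factorial with \<open>k\<close> factors, the smallest of
    which is \<open>q - k + 1\<close>.\<close>
  moreover have "(\<Prod>i\<in>{q - k + 1..q}. q - k + 1) \<le> \<Prod>{q - k + 1..q}"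
    by (intro prod_mono) auto
  ultimately show ?thesis using assms by simp
qed

lemma distinct_words_density:
  "(\<lambda>q. real (card {w \<in> words q k. distinct w}) / real q ^ k) \<longlonglongrightarrow> 1"
proof (rule tendsto_sandwich)
  show "(\<lambda>q. (1 - (real k - 1) / real q) ^ k) \<longlonglongrightarrow> 1"
  proof -
    have "(\<lambda>q. (real k - 1) / real q) \<longlonglongrightarrow> 0"
      by (rule lim_const_over_n)
    then have "(\<lambda>q. (1 - (real k - 1) / real q) ^ k) \<longlonglongrightarrow> (1 - 0) ^ k"
      by (intro tendsto_intros)
    then show ?thesis by simp
  qed
  show "eventually (\<lambda>q. (1 - (real k - 1) / real q) ^ k \<le>
      real (card {w \<in> words q k. distinct w}) / real q ^ k) sequentially"
    \<comment> \<open>From \<open>k + 1\<close> on the natural subtraction \<open>q - k\<close> is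
      not truncated and \<open>q\<close> is positive, also for \<open>k = 0\<close>.\<close>
    using eventually_ge_at_top[of "k + 1"]
  proof eventually_elim
    case (elim q)
    then have "1 - (real k - 1) / real q = real (q - k + 1) / real q"
      by (simp add: field_simps of_nat_diff)
    then have "(1 - (real k - 1) / real q) ^ k = real ((q - k + 1) ^ k) / real q ^ k"
      by (simp add: power_divide)
    also have "\<dots> \<le> real (card {w \<in> words q k. distinct w}) / real q ^ k"
      using card_distinct_words_ge[of k q] elim by (intro divide_right_mono) (auto simp del: of_nat_power)
    finally show ?case .
  qed
  show "eventually (\<lambda>q. real (card {w \<in> words q k. distinct w}) / real q ^ k \<le> 1) sequentially"
    using eventually_gt_at_top[of 0]
  proof eventually_elim
    case (elim q)
    have "card {w \<in> words q k. distinct w} \<le> card (words q k)" by (intro card_mono) auto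
    then have "real (card {w \<in> words q k. distinct w}) \<le> real (q ^ k)"
      by (simp add: card_words del: of_nat_power)
    then show ?case using elim by (simp add: divide_simps)
  qed
qed simp

section \<open>The limit and the asymptotics\<close>

lemma max_cut_count_limit:
  "(\<lambda>q. real (max_cut_count (m + 1) q) / real q ^ (m + 1)) \<longlonglongrightarrow> lambda_sup m"
proof (rule order_tendstoI)
  fix a assume a: "a < lambda_sup m"
  have "Phi m {} \<in> {Phi m A | A. A \<subseteq> unit_cube m \<and> A \<in> sets (lebesgue_pow m)}"
    by auto
  then have "{Phi m A | A. A \<subseteq> unit_cube m \<and> A \<in> sets (lebesgue_pow m)} \<noteq> {}"
    by (simp only: ex_in_conv[symmetric]) (rule exI)
  from less_cSupD[OF this a[unfolded lambda_sup_def]]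
  obtain A where A: "A \<in> sets (lebesgue_pow m)" "a < Phi m A"
    by auto
  \<comment> \<open>One fixed \<open>A\<close> with \<open>Phi m A\<close> above \<open>a\<close>
    works for all large \<open>q\<close>, because the loss factor is the density of words with
    distinct letters.\<close>
  have "(\<lambda>q. Phi m A * (real (card {w \<in> words q (m + 1). distinct w}) / real q ^ (m + 1)))
      \<longlonglongrightarrow> Phi m A * 1"
    by (intro tendsto_intros distinct_words_density)
  then have "eventually (\<lambda>q. a < Phi m A *
      (real (card {w \<in> words q (m + 1). distinct w}) / real q ^ (m + 1))) sequentially"
    using A(2) by (intro order_tendstoD) auto
  then show "eventually (\<lambda>q. a < real (max_cut_count (m + 1) q) / real q ^ (m + 1)) sequentially"
  proof eventually_elim
    case (elim q)
    have "Phi m A * (real (card {w \<in> words q (m + 1). distinct w}) / real q ^ (m + 1))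
        \<le> real (max_cut_count (m + 1) q) / real q ^ (m + 1)"
      using divide_right_mono[OF max_cut_count_lower_Phi[OF A(1), of q], of "real q ^ (m + 1)"]
      by simp
    with elim show ?case by linarith
  qed
next
  fix a assume a: "lambda_sup m < a"
  \<comment> \<open>This half holds for every positive \<open>q\<close>: the ratio never exceeds the
    supremum.\<close>
  show "eventually (\<lambda>q. real (max_cut_count (m + 1) q) / real q ^ (m + 1) < a) sequentially"
    using eventually_gt_at_top[of 0]
    by eventually_elim (use max_cut_count_upper a in \<open>auto intro: le_less_trans\<close>)
qed

lemma smallo_of_ratio_tendsto:
  fixes f :: "nat \<Rightarrow> real"
  assumes "(\<lambda>q. f q / real q ^ k) \<longlonglongrightarrow> c"
  shows "(\<lambda>q. f q - c * real q ^ k) \<in> o(\<lambda>q. real q ^ k)"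
proof (rule smalloI_tendsto)
  show nz: "eventually (\<lambda>q. real q ^ k \<noteq> 0) sequentially"
    using eventually_gt_at_top[of 0] by eventually_elim simp
  have "(\<lambda>q. f q / real q ^ k - c) \<longlonglongrightarrow> 0"
    using tendsto_diff[OF assms tendsto_const[of c]] by simp
  moreover have "eventually (\<lambda>q. f q / real q ^ k - c = (f q - c * real q ^ k) / real q ^ k) sequentially"
    using nz by eventually_elim (simp add: field_simps)
  ultimately show "(\<lambda>q. (f q - c * real q ^ k) / real q ^ k) \<longlonglongrightarrow> 0"
    by (rule Lim_transform_eventually)
qed

theorem theorem2p6:
  fixes k :: nat
  assumes "k \<ge> 2"
  shows "((\<lambda>q. real (max_cut_count k q) / real q ^ k) \<longlonglongrightarrow> lambda_sup (k - 1)) \<and>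
    (\<lambda>q. real (alpha k q) - lambda_sup (k - 1) * real q ^ k) \<in> o(\<lambda>q. real q ^ k) \<and>
    (\<lambda>q. real (alpha_loop k q) - lambda_sup (k - 1) * real q ^ k) \<in> o(\<lambda>q. real q ^ k)"
proof -
  have lim: "(\<lambda>q. real (max_cut_count k q) / real q ^ k) \<longlonglongrightarrow> lambda_sup (k - 1)"
    using max_cut_count_limit[of "k - 1"] assms by simp
  \<comment> \<open>The at most \<open>q\<close> constant words are of lower order, as
    \<open>k \<ge> 2\<close> gives \<open>q / q ^ k \<le> 1 / q\<close>.\<close>
  have error: "(\<lambda>q. real q / real q ^ k) \<longlonglongrightarrow> 0"
  proof (rule Lim_null_comparison)
    show "eventually (\<lambda>q. norm (real q / real q ^ k) \<le> 1 / real q) sequentially"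
      using eventually_gt_at_top[of 0]
    proof eventually_elim
      case (elim q)
      have "real q ^ 2 \<le> real q ^ k" using elim assms by (intro power_increasing) auto
      with elim show ?case by (simp add: divide_simps power2_eq_square)
    qed
    show "(\<lambda>q. 1 / real q) \<longlonglongrightarrow> 0" by (rule lim_const_over_n)
  qed
  have upper_lim: "(\<lambda>q. real (max_cut_count k q) / real q ^ k + real q / real q ^ k)
      \<longlonglongrightarrow> lambda_sup (k - 1)"
    using tendsto_add[OF lim error] by simp
  \<comment> \<open>Stated for a general \<open>f\<close> because \<open>alpha\<close> and
    \<open>alpha_loop\<close> both lie between the maximal cut count and that count plus
    \<open>q\<close>.\<close>
  have sandwich: "(\<lambda>q. real (f q) / real q ^ k) \<longlonglongrightarrow> lambda_sup (k - 1)"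
    if "\<And>q. max_cut_count k q \<le> f q" "\<And>q. f q \<le> max_cut_count k q + q" for f
  proof (rule tendsto_sandwich[OF _ _ lim upper_lim]; intro always_eventually allI)
    fix q
    show "real (max_cut_count k q) / real q ^ k \<le> real (f q) / real q ^ k"
      using that(1) by (intro divide_right_mono) auto
    have "real (f q) \<le> real (max_cut_count k q) + real q"
      using that(2)[of q] by linarith
    then show "real (f q) / real q ^ k \<le> real (max_cut_count k q) / real q ^ k + real q / real q ^ k"
      by (simp add: add_divide_distrib[symmetric] divide_right_mono)
  qed
  have k: "k \<ge> 1" using assms by simp
  note bounds = max_cut_count_le_alpha_loop[OF k] alpha_loop_le_alpha alpha_le[OF k]
  have "(\<lambda>q. real (alpha k q) / real q ^ k) \<longlonglongrightarrow> lambda_sup (k - 1)"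
    by (rule sandwich) (rule order_trans[OF bounds(1,2)], fact bounds(3))
  moreover have "(\<lambda>q. real (alpha_loop k q) / real q ^ k) \<longlonglongrightarrow> lambda_sup (k - 1)"
    by (rule sandwich) (fact bounds(1), rule order_trans[OF bounds(2,3)])
  ultimately show ?thesis using lim by (auto intro: smallo_of_ratio_tendsto)
qed

end
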